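(* Let $a_i \in \mathbb{R}$, $p_i > 0$ ($i=1,\ldots,m$) with $\sum_{i=1}^m p_i = 1$, and let $b_j \in \mathbb{R}$, $q_j > 0$ ($j = 1,\ldots,n$) with $\sum_{j=1}^n q_j = 1$, such that $\sum_{i=1}^m p_i a_i = \sum_{j=1}^n q_j b_j$. Suppose that $a_i \notin (\min_j b_j, \max_j b_j)$ for $i = 1,\ldots,m$. Then there are numbers $\lambda_{ij} \ge 0$ ($1\le i\le m$, $1\le j\le n$) satisfying $\lambda_{i1} + \cdots + \lambda_{in} = p_i$ for every $i$ and $\lambda_{1j} + \cdots + \lambda_{mj} = q_j$ for every $j$, such that $$\frac{\lambda_{1j} a_1 + \cdots + \lambda_{mj} a_m}{\lambda_{1j} + \cdots + \lambda_{mj}} = b_j, \quad j = 1,\ldots,n.$$ *)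

theory Defs
  imports Complex_Main
begin

end

theory Submission
  imports Defs
begin

text \<open>
  Since no \<open>a i\<close> lies strictly between the smallest and the largest \<open>b j\<close>, the sources \<open>a i\<close> split
  into a low group (at most every \<open>b j\<close>) and a high group (at least every \<open>b j\<close>).
  Inside each group mass can be distributed proportionally: a fraction \<open>u j\<close> of every low source and a fraction \<open>v j\<close> of every
  high source is sent to target \<open>j\<close>. Only the masses \<open>PL\<close>, \<open>PH\<close> and first moments \<open>AL\<close>, \<open>AH\<close> of the
  two groups then matter, and requiring mass \<open>q j\<close> and first moment \<open>q j * b j\<close> at target \<open>j\<close> is a
  linear system of size two for \<open>u j\<close> and \<open>v j\<close>, with determinant \<open>PL * AH - PH * AL\<close>. Cramer's rule
  gives the numerators \<open>q j * (AH - PH * b j)\<close> and \<open>q j * (PL * b j - AL)\<close>, which are nonnegative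
  because the two groups lie on either side of \<open>b j\<close>. Equality of the two means makes each family
  of numerators add up to the determinant, so the fractions add up to 1. If the
  determinant is 0, then these sums of nonnegative numerators vanish termwise, so each \<open>b j\<close> equals the common mean,
  and the product coupling \<open>p i * q j\<close> works.
\<close>

text \<open>
  The last clause says that, conditionally on landing in \<open>j\<close>, the mean of \<open>a\<close> is \<open>b j\<close>; as an identity
  of first moments it is linear in \<open>l\<close>, which is what makes the two-by-two system possible. A
  source that satisfies both inequalities may be put in either group, so \<open>L\<close> and \<open>H\<close> are
  parameters and not computed from \<open>a\<close> and \<open>b\<close>.
\<close>

lemma barycentric_coupling_of_separated_sources:
  fixes a p :: "'i \<Rightarrow> real" and b q :: "'j \<Rightarrow> real"
  assumes fin: "finite L" "finite H" "finite J" and disj: "L \<inter> H = {}"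
    and p: "\<And>i. i \<in> L \<union> H \<Longrightarrow> p i \<ge> 0" "sum p (L \<union> H) = 1"
    and q: "\<And>j. j \<in> J \<Longrightarrow> q j > 0" "sum q J = 1"
    and mean: "(\<Sum>i\<in>L \<union> H. p i * a i) = (\<Sum>j\<in>J. q j * b j)"
    and low: "\<And>i j. i \<in> L \<Longrightarrow> j \<in> J \<Longrightarrow> a i \<le> b j"
    and high: "\<And>i j. i \<in> H \<Longrightarrow> j \<in> J \<Longrightarrow> b j \<le> a i"
  shows "\<exists>l :: 'i \<Rightarrow> 'j \<Rightarrow> real.
    (\<forall>i\<in>L \<union> H. \<forall>j\<in>J. l i j \<ge> 0) \<and>
    (\<forall>i\<in>L \<union> H. (\<Sum>j\<in>J. l i j) = p i) \<and>
    (\<forall>j\<in>J. (\<Sum>i\<in>L \<union> H. l i j) = q j) \<and>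
    (\<forall>j\<in>J. (\<Sum>i\<in>L \<union> H. l i j * a i) = q j * b j)"
proof -
  define PL PH where "PL = sum p L" and "PH = sum p H"
  define AL AH where "AL = (\<Sum>i\<in>L. p i * a i)" and "AH = (\<Sum>i\<in>H. p i * a i)"
  define c where "c = (\<Sum>j\<in>J. q j * b j)"
  define D where "D = PL * AH - PH * AL"
  have mass: "PL + PH = 1"
    using p(2) fin disj by (simp add: PL_def PH_def sum.union_disjoint)
  have moment: "AL + AH = c"
    using mean fin disj by (simp add: AL_def AH_def c_def sum.union_disjoint)
  have low_nonneg: "PL * b j - AL \<ge> 0" if "j \<in> J" for j
    unfolding PL_def AL_def sum_distrib_right
    using p(1) low[OF _ that] by (auto intro!: sum_mono mult_left_mono)
  have high_nonneg: "AH - PH * b j \<ge> 0" if "j \<in> J" for j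
    unfolding PH_def AH_def sum_distrib_right
    using p(1) high[OF _ that] by (auto intro!: sum_mono mult_left_mono)
  \<comment> \<open>The Cramer numerators for \<open>u\<close>, and likewise those for \<open>v\<close>, add up to the determinant.\<close>
  have PL_eq: "PL = 1 - PH" and AL_eq: "AL = c - AH"
    using mass moment by simp_all
  have sum_high: "(\<Sum>j\<in>J. q j * (AH - PH * b j)) = D"
  proof -
    have "(\<Sum>j\<in>J. q j * (AH - PH * b j)) = (\<Sum>j\<in>J. AH * q j - PH * (q j * b j))"
      by (simp add: algebra_simps)
    also have "\<dots> = AH * sum q J - PH * c"
      by (simp add: c_def sum_subtractf sum_distrib_left)
    also have "\<dots> = D"
      by (simp add: D_def q(2) PL_eq AL_eq algebra_simps)
    finally show ?thesis .
  qed
  have sum_low: "(\<Sum>j\<in>J. q j * (PL * b j - AL)) = D"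
  proof -
    have "(\<Sum>j\<in>J. q j * (PL * b j - AL)) = (\<Sum>j\<in>J. PL * (q j * b j) - AL * q j)"
      by (simp add: algebra_simps)
    also have "\<dots> = PL * c - AL * sum q J"
      by (simp add: c_def sum_subtractf sum_distrib_left)
    also have "\<dots> = D"
      by (simp add: D_def q(2) PL_eq AL_eq algebra_simps)
    finally show ?thesis .
  qed
  show ?thesis
  proof (cases "D = 0")
    case True
    have b_eq: "b j = c" if j: "j \<in> J" for j
    proof -
      have "q j * (AH - PH * b j) = 0"
        using sum_nonneg_eq_0_iff[of J "\<lambda>j. q j * (AH - PH * b j)"] fin(3) high_nonneg q(1)
          sum_high True j by (simp add: less_imp_le)
      moreover have "q j * (PL * b j - AL) = 0"
        using sum_nonneg_eq_0_iff[of J "\<lambda>j. q j * (PL * b j - AL)"] fin(3) low_nonneg q(1)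
          sum_low True j by (simp add: less_imp_le)
      ultimately have "AH = PH * b j" "AL = PL * b j"
        using q(1)[OF j] by auto
      then have "c = (PL + PH) * b j"
        using moment by (simp add: algebra_simps)
      then show ?thesis
        by (simp add: mass)
    qed
    have first_moment: "(\<Sum>i\<in>L \<union> H. p i * q j * a i) = q j * c" for j
    proof -
      have "(\<Sum>i\<in>L \<union> H. p i * q j * a i) = (\<Sum>i\<in>L \<union> H. q j * (p i * a i))"
        by (simp add: mult_ac)
      also have "\<dots> = q j * c"
        by (simp add: sum_distrib_left[symmetric] mean c_def)
      finally show ?thesis .
    qed
    show ?thesis
    proof (intro exI[of _ "\<lambda>i j. p i * q j"] conjI ballI)
      show "p i * q j \<ge> 0" if "i \<in> L \<union> H" "j \<in> J" for i j
        using p(1)[OF that(1)] q(1)[OF that(2)] by simp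
      show "(\<Sum>j\<in>J. p i * q j) = p i" for i
        by (simp add: sum_distrib_left[symmetric] q(2))
      show "(\<Sum>i\<in>L \<union> H. p i * q j) = q j" for j
        by (simp add: sum_distrib_right[symmetric] p(2))
      show "(\<Sum>i\<in>L \<union> H. p i * q j * a i) = q j * b j" if "j \<in> J" for j
        using first_moment b_eq[OF that] by simp
    qed
  next
    case False
    have "D \<ge> 0"
      unfolding sum_high[symmetric] using q(1) high_nonneg
      by (intro sum_nonneg mult_nonneg_nonneg) (auto simp: less_imp_le)
    with False have D: "D > 0" by simp
    define u where "u j = q j * (AH - PH * b j) / D" for j
    define v where "v j = q j * (PL * b j - AL) / D" for j
    define l where "l i j = p i * (if i \<in> L then u j else v j)" for i j
    have u_nonneg: "u j \<ge> 0" and v_nonneg: "v j \<ge> 0" if "j \<in> J" for j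
      using that D q(1)[OF that] low_nonneg[OF that] high_nonneg[OF that]
      by (simp_all add: u_def v_def)
    have sum_u: "sum u J = 1" and sum_v: "sum v J = 1"
      using sum_high sum_low D by (simp_all add: u_def v_def sum_divide_distrib[symmetric])
    have split: "(\<Sum>i\<in>L \<union> H. l i j * f i)
        = (\<Sum>i\<in>L. p i * f i) * u j + (\<Sum>i\<in>H. p i * f i) * v j" for f j
    proof -
      have "(\<Sum>i\<in>L \<union> H. l i j * f i) = (\<Sum>i\<in>L. l i j * f i) + (\<Sum>i\<in>H. l i j * f i)"
        using fin disj by (simp add: sum.union_disjoint)
      also have "(\<Sum>i\<in>L. l i j * f i) = (\<Sum>i\<in>L. p i * f i) * u j"
        unfolding sum_distrib_right by (rule sum.cong) (simp_all add: l_def)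
      also have "(\<Sum>i\<in>H. l i j * f i) = (\<Sum>i\<in>H. p i * f i) * v j"
        unfolding sum_distrib_right using disj by (intro sum.cong) (auto simp: l_def)
      finally show ?thesis .
    qed
    show ?thesis
    proof (intro exI[of _ l] conjI ballI)
      show "l i j \<ge> 0" if "i \<in> L \<union> H" "j \<in> J" for i j
        using p(1)[OF that(1)] u_nonneg[OF that(2)] v_nonneg[OF that(2)] by (simp add: l_def)
      show "(\<Sum>j\<in>J. l i j) = p i" for i
        by (cases "i \<in> L") (simp_all add: l_def sum_distrib_left[symmetric] sum_u sum_v)
      show "(\<Sum>i\<in>L \<union> H. l i j) = q j" for j
      proof -
        have "(\<Sum>i\<in>L \<union> H. l i j) = PL * u j + PH * v j"
          using split[of j "\<lambda>_. 1"] by (simp add: PL_def PH_def)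
        also have "\<dots> = q j * (PL * AH - PH * AL) / D"
          using D by (simp add: u_def v_def field_simps)
        finally show ?thesis using D by (simp add: D_def)
      qed
      show "(\<Sum>i\<in>L \<union> H. l i j * a i) = q j * b j" for j
      proof -
        have "(\<Sum>i\<in>L \<union> H. l i j * a i) = AL * u j + AH * v j"
          using split[of j a] by (simp add: AL_def AH_def)
        also have "\<dots> = q j * b j * (PL * AH - PH * AL) / D"
          using D by (simp add: u_def v_def field_simps)
        finally show ?thesis using D by (simp add: D_def)
      qed
    qed
  qed
qed

theorem theorem2p7:
  fixes m n :: nat
    and a p b q :: "nat \<Rightarrow> real"
  assumes "\<And>i. i \<in> {1..m} \<Longrightarrow> p i > 0"
    and "(\<Sum>i=1..m. p i) = 1"
    and "\<And>j. j \<in> {1..n} \<Longrightarrow> q j > 0"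
    and "(\<Sum>j=1..n. q j) = 1"
    and "(\<Sum>i=1..m. p i * a i) = (\<Sum>j=1..n. q j * b j)"
    and "\<And>i. i \<in> {1..m} \<Longrightarrow> a i \<notin> {Min (b ` {1..n})<..<Max (b ` {1..n})}"
  shows "\<exists>l :: nat \<Rightarrow> nat \<Rightarrow> real.
    (\<forall>i\<in>{1..m}. \<forall>j\<in>{1..n}. l i j \<ge> 0) \<and>
    (\<forall>i\<in>{1..m}. (\<Sum>j=1..n. l i j) = p i) \<and>
    (\<forall>j\<in>{1..n}. (\<Sum>i=1..m. l i j) = q j) \<and>
    (\<forall>j\<in>{1..n}. (\<Sum>i=1..m. l i j * a i) / (\<Sum>i=1..m. l i j) = b j)"
proof -
  define \<beta>\<^sub>1 \<beta>\<^sub>2 where "\<beta>\<^sub>1 = Min (b ` {1..n})" and "\<beta>\<^sub>2 = Max (b ` {1..n})"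
  define L where "L = {i \<in> {1..m}. a i \<le> \<beta>\<^sub>1}"
  define H where "H = {i \<in> {1..m}. \<not> a i \<le> \<beta>\<^sub>1}"
  have LH: "{1..m} = L \<union> H" and disj: "L \<inter> H = {}"
    by (auto simp: L_def H_def)
  have between: "\<beta>\<^sub>1 \<le> b j" "b j \<le> \<beta>\<^sub>2" if "j \<in> {1..n}" for j
    using that by (auto simp: \<beta>\<^sub>1_def \<beta>\<^sub>2_def)
  have low: "a i \<le> b j" if "i \<in> L" "j \<in> {1..n}" for i j
    using that(1) between(1)[OF that(2)] by (simp add: L_def)
  have high: "b j \<le> a i" if "i \<in> H" "j \<in> {1..n}" for i j
    using that(1) between(2)[OF that(2)] assms(6)[of i]
    by (auto simp: H_def \<beta>\<^sub>1_def \<beta>\<^sub>2_def)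
  have "\<exists>l :: nat \<Rightarrow> nat \<Rightarrow> real.
    (\<forall>i\<in>L \<union> H. \<forall>j\<in>{1..n}. l i j \<ge> 0) \<and>
    (\<forall>i\<in>L \<union> H. (\<Sum>j=1..n. l i j) = p i) \<and>
    (\<forall>j\<in>{1..n}. (\<Sum>i\<in>L \<union> H. l i j) = q j) \<and>
    (\<forall>j\<in>{1..n}. (\<Sum>i\<in>L \<union> H. l i j * a i) = q j * b j)"
  proof (rule barycentric_coupling_of_separated_sources)
    show "finite L" "finite H"
      by (simp_all add: L_def H_def)
    show "p i \<ge> 0" if "i \<in> L \<union> H" for i
      using assms(1)[of i] that unfolding LH by (simp add: less_imp_le)
  qed (use assms(2-5) disj low high in \<open>simp_all add: LH[symmetric]\<close>)
  then obtain l where l: "\<forall>i\<in>{1..m}. \<forall>j\<in>{1..n}. l i j \<ge> 0"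
    "\<forall>i\<in>{1..m}. (\<Sum>j=1..n. l i j) = p i"
    "\<forall>j\<in>{1..n}. (\<Sum>i=1..m. l i j) = q j"
    "\<forall>j\<in>{1..n}. (\<Sum>i=1..m. l i j * a i) = q j * b j"
    unfolding LH by blast
  have "(\<Sum>i=1..m. l i j * a i) / (\<Sum>i=1..m. l i j) = b j" if j: "j \<in> {1..n}" for j
    using l(3,4) j assms(3)[OF j] by simp
  with l show ?thesis
    by blast
qed

end
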